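(* For every positive integer $m$, $$\mathrm{forb}(m,F(0,9,1,0))\le \Big\lfloor \tfrac{31}{5}m\Big\rfloor+1,$$ with equality when $m\equiv 0\pmod 5$.
   Context: A matrix is simple if it is a $(0,1)$-matrix with no repeated columns. For $(0,1)$-matrices $F,A$, $F$ is a configuration in $A$ (written $F\prec A$) if some submatrix of $A$ is a row and column permutation of $F$. $\mathrm{Avoid}(m,F)$ is the set of all simple $m$-rowed matrices $A$ with $F\not\prec A$, and $\mathrm{forb}(m,F)$ is the maximum number of columns of a matrix in $\mathrm{Avoid}(m,F)$. For $p\ge 1$, $F(0,p,1,0)$ is the $2\times(p+1)$ matrix whose first $p$ columns are $\binom{1}{0}$ and whose last column is $\binom{0}{1}$. *)

theory Defs
  imports
    "HOL-Combinatorics.Permutations"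
    "Jordan_Normal_Form.Matrix"
    "Jordan_Normal_Form.DL_Submatrix"
begin

definition zero_one_mat :: "nat mat \<Rightarrow> bool" where
  "zero_one_mat A \<longleftrightarrow> elements_mat A \<subseteq> {0, 1}"

definition simple_mat :: "nat mat \<Rightarrow> bool" where
  "simple_mat A \<longleftrightarrow> zero_one_mat A \<and> distinct (cols A)"

definition row_col_permutation :: "nat mat \<Rightarrow> nat mat \<Rightarrow> bool" where
  "row_col_permutation B F \<longleftrightarrow>
     (\<exists>p q. p permutes {..<dim_row F} \<and> q permutes {..<dim_col F} \<and>
        B = mat (dim_row F) (dim_col F) (\<lambda>(i, j). F $$ (p i, q j)))"

definition configuration :: "nat mat \<Rightarrow> nat mat \<Rightarrow> bool" (infix \<open>\<prec>\<close> 50) where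
  "F \<prec> A \<longleftrightarrow> (\<exists>I J. I \<subseteq> {..<dim_row A} \<and> J \<subseteq> {..<dim_col A} \<and>
     row_col_permutation (submatrix A I J) F)"

definition Avoid :: "nat \<Rightarrow> nat mat \<Rightarrow> nat mat set" where
  "Avoid m F = {A. dim_row A = m \<and> simple_mat A \<and> \<not> F \<prec> A}"

definition forb :: "nat \<Rightarrow> nat mat \<Rightarrow> nat" where
  "forb m F = Max (dim_col ` Avoid m F)"

definition F0p10 :: "nat \<Rightarrow> nat mat" where
  "F0p10 p = mat_of_cols 2 (replicate p (vec_of_list [1, 0]) @ [vec_of_list [0, 1]])"

text \<open>The maximum in \<open>forb\<close> ranges over a finite set, which is nonempty whenever \<open>F\<close> has a
  column, since then the matrix with \<open>m\<close> rows and no columns avoids \<open>F\<close>.\<close>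

lemma finite_dim_col_Avoid: "finite (dim_col ` Avoid m F)"
proof (rule finite_subset)
  let ?V = "vec_of_list ` {xs. set xs \<subseteq> {0, 1 :: nat} \<and> length xs = m}"
  have fin: "finite ?V"
    by (intro finite_imageI finite_lists_length_eq) simp
  show "dim_col ` Avoid m F \<subseteq> {..card ?V}"
  proof clarify
    fix A assume "A \<in> Avoid m F"
    then have r: "dim_row A = m" and e: "elements_mat A \<subseteq> {0, 1}" and d: "distinct (cols A)"
      by (auto simp: Avoid_def simple_mat_def zero_one_mat_def)
    have "set (cols A) \<subseteq> ?V"
    proof
      fix v assume "v \<in> set (cols A)"
      then obtain j where j: "j < dim_col A" "v = col A j"
        by (auto simp: cols_def)
      have "A $$ (i, j) \<in> {0, 1}" if "i < m" for i
        using that j r e elements_matI[of A m "dim_col A" i j] by blast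
      then have "set (list_of_vec v) \<subseteq> {0, 1}"
        using j r by (fastforce simp: set_list_of_vec vec_set_def)
      moreover have "length (list_of_vec v) = m"
        using j r by simp
      ultimately show "v \<in> ?V"
        by (intro image_eqI[of _ _ "list_of_vec v"]) (auto simp: vec_list)
    qed
    then have "card (set (cols A)) \<le> card ?V"
      using fin by (rule card_mono[rotated])
    then show "dim_col A \<le> card ?V"
      using distinct_card[OF d] by simp
  qed
qed simp

lemma Avoid_nonempty:
  assumes "dim_col F > 0"
  shows "Avoid m F \<noteq> {}"
proof -
  have "mat m 0 (\<lambda>_. 0) \<in> Avoid m F"
    using assms dim_submatrix(2)[of "mat m 0 (\<lambda>_. 0 :: nat)"]
    by (auto simp: Avoid_def simple_mat_def zero_one_mat_def elements_mat_def cols_def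
        configuration_def row_col_permutation_def dest!: arg_cong[of _ _ dim_col])
  then show ?thesis by blast
qed

end

theory Submission
  imports Defs
begin

text \<open>
  View a matrix as a family \<open>U\<close> of columns, each a set of rows.  It avoids \<open>F(0,9,1,0)\<close> iff any
  two rows are either nested (as sets of columns) or \<^emph>\<open>crossing\<close>, with at most 8 columns in each
  of the two differences.  In a minimal counterexample to \<open>5|U| \<le> 31m + 5\<close> deleting a row loses at
  least 7 columns, so every row crosses at least three others.

  If every pair of rows is distinguished by at most 16 columns, double counting the pairs that a
  column distinguishes gives the bound, because a column of size \<open>s\<close> distinguishes \<open>s(m - s)\<close> pairs.

  Otherwise some \<open>a\<close> and \<open>b\<close> are distinguished by more than 16 columns; enlarge \<open>a\<close> to an
  inclusion-maximal row \<open>v\<close> and shrink \<open>b\<close> to a minimal row \<open>w\<close>.  Their distance \<open>D\<close> in the crossing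
  graph is at least 3, since \<open>v - w\<close> has at most \<open>8D\<close> columns.  If \<open>D\<close> is infinite, the component of
  \<open>v\<close> lies above all other rows and the two parts are treated separately.  If \<open>D\<close> is finite, the
  columns missing \<open>v\<close> live on the neighbours of \<open>v\<close>, those containing \<open>w\<close> are dually controlled by
  the neighbours of \<open>w\<close>, and the breadth-first layers between \<open>v\<close> and \<open>w\<close> contain enough rows to
  pay for the remaining \<open>8D\<close> columns.

  Equality: stack \<open>m / 5\<close> copies of the full matrix on 5 rows along a chain, so that the all-ones
  column of one block is the all-zeros column of the next.
\<close>

subsection \<open>Families with nested or crossing rows\<close>

definition sep :: "'a set set \<Rightarrow> 'a \<Rightarrow> 'a \<Rightarrow> 'a set set" where
  "sep U i j = {S \<in> U. i \<in> S \<and> j \<notin> S}"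

text \<open>The quantifiers range over ordered pairs: of any two rows, either one difference is
  empty or both have at most 8 columns, one less than the nine repeated columns of
  F(0,9,1,0).\<close>

definition balanced :: "'a set \<Rightarrow> 'a set set \<Rightarrow> bool" where
  "balanced R U \<longleftrightarrow> finite R \<and> U \<subseteq> Pow R \<and>
     (\<forall>i\<in>R. \<forall>j\<in>R. card (sep U i j) \<le> 8 \<or> sep U j i = {})"

definition crossing :: "'a set set \<Rightarrow> 'a \<Rightarrow> 'a \<Rightarrow> bool" where
  "crossing U i j \<longleftrightarrow> sep U i j \<noteq> {} \<and> sep U j i \<noteq> {}"

definition nbrs :: "'a set \<Rightarrow> 'a set set \<Rightarrow> 'a \<Rightarrow> 'a set" where
  "nbrs R U i = {j \<in> R. crossing U i j}"

lemma crossing_sym: "crossing U i j \<longleftrightarrow> crossing U j i"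
  by (auto simp: crossing_def)

lemma crossing_irrefl [simp]: "\<not> crossing U i i"
  by (auto simp: crossing_def sep_def)

lemma balanced_finite:
  assumes "balanced R U"
  shows "finite R" "finite U" "U \<subseteq> Pow R" "finite (sep U i j)" "finite (nbrs R U i)"
proof -
  show *: "finite R" "U \<subseteq> Pow R"
    using assms by (auto simp: balanced_def)
  then show "finite U"
    by (meson finite_Pow_iff finite_subset)
  then show "finite (sep U i j)"
    by (auto simp: sep_def)
  show "finite (nbrs R U i)"
    using * by (auto simp: nbrs_def)
qed

lemma balanced_crossing:
  assumes "balanced R U" "i \<in> R" "j \<in> R" "crossing U i j"
  shows "card (sep U i j) \<le> 8"
  using assms unfolding balanced_def crossing_def by blast

text \<open>A difference in the trace is the image of the old one, so it cannot grow, and an empty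
  one stays empty. This permits induction on the set of rows.\<close>

lemma balanced_trace:
  assumes "balanced R U" "R' \<subseteq> R"
  shows "balanced R' ((\<lambda>S. S \<inter> R') ` U)"
proof -
  have *: "sep ((\<lambda>S. S \<inter> R') ` U) i j = (\<lambda>S. S \<inter> R') ` sep U i j" if "i \<in> R'" "j \<in> R'" for i j
    using that by (auto simp: sep_def)
  have "card (sep ((\<lambda>S. S \<inter> R') ` U) i j) \<le> 8 \<or> sep ((\<lambda>S. S \<inter> R') ` U) j i = {}"
    if "i \<in> R'" "j \<in> R'" for i j
  proof -
    have "card (sep U i j) \<le> 8 \<or> sep U j i = {}"
      using assms that unfolding balanced_def by blast
    moreover have "card ((\<lambda>S. S \<inter> R') ` sep U i j) \<le> card (sep U i j)"
      using balanced_finite(4)[OF assms(1)] by (rule card_image_le)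
    ultimately show ?thesis
      using that by (auto simp: *)
  qed
  then show ?thesis
    using assms by (auto simp: balanced_def intro: finite_subset)
qed

lemma sep_complement:
  assumes "i \<in> R" "j \<in> R" "U \<subseteq> Pow R"
  shows "sep ((\<lambda>S. R - S) ` U) i j = (\<lambda>S. R - S) ` sep U j i"
  using assms by (auto simp: sep_def)

lemma inj_on_complement: "U \<subseteq> Pow R \<Longrightarrow> inj_on (\<lambda>S. R - S) U"
  by (rule inj_onI) (metis Pow_iff double_diff subsetD subset_refl)

text \<open>Complementing columns swaps \<open>sep U i j\<close> with \<open>sep U j i\<close>; this
  is the duality between maximal and minimal rows.\<close>

lemma balanced_complement:
  assumes "balanced R U"
  shows "balanced R ((\<lambda>S. R - S) ` U)"
proof -
  have U: "U \<subseteq> Pow R" and fin: "finite R"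
    using assms by (auto simp: balanced_def)
  have "card (sep ((\<lambda>S. R - S) ` U) i j) \<le> 8 \<or> sep ((\<lambda>S. R - S) ` U) j i = {}"
    if "i \<in> R" "j \<in> R" for i j
  proof -
    have "card (sep U j i) \<le> 8 \<or> sep U i j = {}"
      using assms that unfolding balanced_def by blast
    moreover have "card ((\<lambda>S. R - S) ` sep U j i) \<le> card (sep U j i)"
      using balanced_finite(4)[OF assms(1)] by (rule card_image_le)
    ultimately show ?thesis
      using that U by (auto simp: sep_complement)
  qed
  then show ?thesis
    using fin by (auto simp: balanced_def)
qed

lemma nbrs_complement:
  assumes "i \<in> R" "U \<subseteq> Pow R"
  shows "nbrs R ((\<lambda>S. R - S) ` U) i = nbrs R U i"
  using assms by (auto simp: nbrs_def crossing_def sep_complement)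

text \<open>Two columns merge when \<open>i\<close> is deleted exactly if they differ only in
  \<open>i\<close>; the loss counts each such pair by its member without \<open>i\<close>.\<close>

lemma card_trace_delete:
  assumes "finite U" "U \<subseteq> Pow R" "i \<in> R"
  shows "card U = card ((\<lambda>S. S \<inter> (R - {i})) ` U) + card {S \<in> U. i \<notin> S \<and> insert i S \<in> U}"
proof -
  define V where "V = {S \<in> U. i \<notin> S}"
  define W where "W = {S \<in> U. i \<in> S}"
  define W' where "W' = (\<lambda>S. S - {i}) ` W"
  have fin: "finite V" "finite W" "finite W'"
    using assms by (auto simp: V_def W_def W'_def)
  have "U = V \<union> W" "V \<inter> W = {}"
    by (auto simp: V_def W_def)
  then have 1: "card U = card V + card W"
    using fin card_Un_disjoint by metis
  have "inj_on (\<lambda>S. S - {i}) W"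
    by (rule inj_onI) (auto simp: W_def)
  then have 2: "card W' = card W"
    by (auto simp: W'_def card_image)
  have "S \<inter> (R - {i}) = (if i \<in> S then S - {i} else S)" if "S \<in> U" for S
    using that assms by auto
  then have "(\<lambda>S. S \<inter> (R - {i})) ` U = (\<lambda>S. if i \<in> S then S - {i} else S) ` U"
    by (rule image_cong[OF refl])
  also have "\<dots> = V \<union> W'"
    by (auto simp: V_def W_def W'_def image_iff)
  finally have 3: "(\<lambda>S. S \<inter> (R - {i})) ` U = V \<union> W'" .
  have "{S \<in> U. i \<notin> S \<and> insert i S \<in> U} = V \<inter> W'"
  proof (intro Set.set_eqI iffI)
    fix S assume S: "S \<in> {S \<in> U. i \<notin> S \<and> insert i S \<in> U}"
    then have "insert i S \<in> W" "S = insert i S - {i}"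
      by (auto simp: W_def)
    then show "S \<in> V \<inter> W'"
      using S by (auto simp: V_def W'_def)
  next
    fix S assume "S \<in> V \<inter> W'"
    then show "S \<in> {S \<in> U. i \<notin> S \<and> insert i S \<in> U}"
      by (auto simp: V_def W'_def W_def insert_absorb)
  qed
  then show ?thesis
    using 1 2 3 card_Un_Int[OF fin(1) fin(3)] by simp
qed

text \<open>A column to which \<open>i\<close> can be added is determined by its trace on the neighbours of \<open>i\<close>.\<close>
lemma card_nbrs_ge:
  assumes bal: "balanced R U" and "i \<in> R"
    and t: "7 \<le> card {S \<in> U. i \<notin> S \<and> insert i S \<in> U}"
  shows "3 \<le> card (nbrs R U i)"
proof -
  define T where "T = {S \<in> U. i \<notin> S \<and> insert i S \<in> U}"
  define N where "N = nbrs R U i"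
  have fin: "finite N" and UR: "U \<subseteq> Pow R"
    using balanced_finite[OF bal] by (auto simp: N_def)
  have "S \<subseteq> S'" if S: "S \<in> T" "S' \<in> T" "S \<inter> N = S' \<inter> N" for S S'
  proof
    fix j assume j: "j \<in> S"
    show "j \<in> S'"
    proof (rule ccontr)
      assume nj: "j \<notin> S'"
      \<comment> \<open>These two columns show that \<open>i\<close> and \<open>j\<close> cross, so
        \<open>j\<close> is a neighbour of \<open>i\<close>, where the two traces agree.\<close>
      have "S \<in> sep U j i" "insert i S' \<in> sep U i j"
        using S j nj by (auto simp: T_def sep_def)
      moreover have "j \<in> R"
        using S j UR by (auto simp: T_def)
      ultimately have "j \<in> N"
        by (auto simp: N_def nbrs_def crossing_def)
      then show False
        using S j nj by auto
    qed
  qed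
  then have "inj_on (\<lambda>S. S \<inter> N) T"
    by (intro inj_onI) (metis subset_antisym)
  then have "card T \<le> card (Pow N)"
    using fin by (intro card_inj_on_le[of "\<lambda>S. S \<inter> N"]) auto
  then have "7 \<le> (2::nat) ^ card N"
    using t fin by (simp add: card_Pow T_def)
  moreover have "(2::nat) ^ card N \<le> 2 ^ 2" if "card N \<le> 2"
    using that by (intro power_increasing) auto
  ultimately show ?thesis
    by (fold N_def) (rule ccontr, simp)
qed

section \<open>Columns at maximal and minimal rows\<close>

lemma finite_sum_card_swap:
  assumes "finite A" "finite B"
  shows "(\<Sum>a\<in>A. card {b \<in> B. P a b}) = (\<Sum>b\<in>B. card {a \<in> A. P a b})"
  using sum_multicount_gen[OF assms, of P "\<lambda>b. card {a \<in> A. P a b}"] assms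
  by auto

text \<open>For \<open>card N \<le> 4\<close> this is \<open>card B \<le> 2 ^ card N - 1\<close>; from 5 on it is \<open>2 card B \<le> 9 card N\<close>,
  as all but \<open>card N\<close> members have at least two elements.\<close>
lemma card_low_degree_family:
  assumes "finite N" "B \<subseteq> Pow N - {{}}"
    and deg: "\<And>j. j \<in> N \<Longrightarrow> card {S \<in> B. j \<in> S} \<le> 8" and d: "3 \<le> card N"
  shows "10 * card B + 81 \<le> 62 * card N"
proof -
  have finB: "finite B"
    using assms by (meson finite_Diff finite_Pow_iff finite_subset)
  have finS: "finite S" if "S \<in> B" for S
    using that assms by (auto intro: finite_subset)
  have "card B \<le> card (Pow N - {{}})"
    using assms by (intro card_mono) auto
  also have "\<dots> = 2 ^ card N - 1"
    using assms by (simp add: card_Pow)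
  finally have pow: "card B \<le> 2 ^ card N - 1" .
  define B1 where "B1 = {S \<in> B. card S = 1}"
  have "B1 \<subseteq> (\<lambda>j. {j}) ` N"
    using assms by (auto simp: B1_def card_1_singleton_iff)
  then have b1: "card B1 \<le> card N"
    using assms by (meson surj_card_le)
  have "(\<Sum>S\<in>B. card S) = (\<Sum>S\<in>B. card {j \<in> N. j \<in> S})"
    using assms by (intro sum.cong refl arg_cong[of _ _ card]) auto
  also have "\<dots> = (\<Sum>j\<in>N. card {S \<in> B. j \<in> S})"
    using finB assms by (intro finite_sum_card_swap)
  also have "\<dots> \<le> (\<Sum>j\<in>N. 8)"
    by (intro sum_mono deg)
  finally have up: "(\<Sum>S\<in>B. card S) \<le> 8 * card N"
    by simp
  have ge: "2 \<le> card S + of_bool (S \<in> B1)" if "S \<in> B" for S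
  proof -
    have "card S \<noteq> 0"
      using that assms finS by auto
    then show ?thesis
      using that by (cases "card S = 1") (auto simp: B1_def)
  qed
  have "2 * card B = (\<Sum>S\<in>B. 2)"
    by simp
  also have "\<dots> \<le> (\<Sum>S\<in>B. card S + of_bool (S \<in> B1))"
    by (intro sum_mono ge)
  also have "\<dots> = (\<Sum>S\<in>B. card S) + card B1"
    using finB by (auto simp: sum.distrib B1_def Int_def)
  finally have "2 * card B \<le> 9 * card N"
    using up b1 by simp
  \<comment> \<open>Sizes 3 and 4 need 70 + 81 <= 186 and 150 + 81 <= 248; from 5 on, 45n + 81 <=
    62n for n = \<open>card N\<close>. The constant 81 is chosen for the final count in
    \<open>card_le_of_far_pair\<close>.\<close>
  moreover have "card N = 3 \<or> card N = 4 \<or> 5 \<le> card N"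
    using d by linarith
  ultimately show ?thesis
    using pow by auto
qed

text \<open>A row of a column missing \<open>v\<close> is not below \<open>v\<close>, so by
  maximality it crosses \<open>v\<close>. Such columns thus live on the neighbours of
  \<open>v\<close>, each of which lies in at most 8 of them.\<close>

lemma card_avoiding_maximal:
  assumes bal: "balanced R U" and v: "v \<in> R" and d: "3 \<le> card (nbrs R U v)"
    and max: "\<And>j. j \<in> R \<Longrightarrow> sep U v j = {} \<Longrightarrow> sep U j v = {}"
  shows "10 * card {S \<in> U. v \<notin> S \<and> S \<noteq> {}} + 81 \<le> 62 * card (nbrs R U v)"
proof (rule card_low_degree_family)
  note fin = balanced_finite[OF bal]
  show "finite (nbrs R U v)" "3 \<le> card (nbrs R U v)"
    using fin d by auto
  have "S \<subseteq> nbrs R U v" if "S \<in> U" "v \<notin> S" for S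
  proof
    fix j assume "j \<in> S"
    then have "j \<in> R" "S \<in> sep U j v"
      using that fin(3) by (auto simp: sep_def)
    then show "j \<in> nbrs R U v"
      using max[of j] by (auto simp: nbrs_def crossing_def)
  qed
  then show "{S \<in> U. v \<notin> S \<and> S \<noteq> {}} \<subseteq> Pow (nbrs R U v) - {{}}"
    by auto
  fix j assume j: "j \<in> nbrs R U v"
  then have "crossing U j v" "j \<in> R"
    by (auto simp: nbrs_def crossing_sym)
  then have "card (sep U j v) \<le> 8"
    using bal v by (intro balanced_crossing)
  moreover have "card {S \<in> {S \<in> U. v \<notin> S \<and> S \<noteq> {}}. j \<in> S} \<le> card (sep U j v)"
    using fin by (intro card_mono) (auto simp: sep_def)
  ultimately show "card {S \<in> {S \<in> U. v \<notin> S \<and> S \<noteq> {}}. j \<in> S} \<le> 8"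
    by linarith
qed

text \<open>The dual of \<open>card_avoiding_maximal\<close>, obtained by complementing all
  columns.\<close>

lemma card_containing_minimal:
  assumes bal: "balanced R U" and v: "v \<in> R" and d: "3 \<le> card (nbrs R U v)"
    and min: "\<And>j. j \<in> R \<Longrightarrow> sep U j v = {} \<Longrightarrow> sep U v j = {}"
  shows "10 * card {S \<in> U. v \<in> S \<and> S \<noteq> R} + 81 \<le> 62 * card (nbrs R U v)"
proof -
  note fin = balanced_finite[OF bal]
  let ?V = "(\<lambda>S. R - S) ` U"
  have "10 * card {S \<in> ?V. v \<notin> S \<and> S \<noteq> {}} + 81 \<le> 62 * card (nbrs R ?V v)"
    using balanced_complement[OF bal] v d min fin
    by (intro card_avoiding_maximal) (auto simp: nbrs_complement sep_complement)
  moreover have "{S \<in> ?V. v \<notin> S \<and> S \<noteq> {}} = (\<lambda>S. R - S) ` {S \<in> U. v \<in> S \<and> S \<noteq> R}"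
    using fin(3) v by auto
  moreover have "card ((\<lambda>S. R - S) ` {S \<in> U. v \<in> S \<and> S \<noteq> R}) = card {S \<in> U. v \<in> S \<and> S \<noteq> R}"
    using fin(3) by (intro card_image inj_on_complement) auto
  ultimately show ?thesis
    using fin v by (simp add: nbrs_complement)
qed

section \<open>Double counting when few columns distinguish each pair of rows\<close>

lemma card_cut_two_ge:
  fixes m s :: nat
  assumes "s \<le> m" "2 \<le> s" "s + 2 \<le> m"
  shows "2 * (m - 2) \<le> s * (m - s)"
proof -
  obtain a where a: "s = a + 2" using assms by (metis add.commute le_Suc_ex)
  obtain b where b: "m = a + 4 + b" using assms a by (metis add.commute add.left_commute le_Suc_ex numeral_Bit0)
  \<comment> \<open>In these coordinates the two sides differ by \<open>a * b\<close>.\<close>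
  show ?thesis by (simp add: a b algebra_simps)
qed

text \<open>With m = \<open>card R\<close>, a column of size s separates s(m - s) ordered pairs.
  This is at least 2(m - 2), except for at most two columns of size 0 or m and at most 2m of size 1
  or m - 1, while the total is at most 8m(m - 1).\<close>

lemma card_le_of_cuts_le:
  assumes bal: "balanced R U" and m5: "5 \<le> card R"
    and cut: "\<And>i j. i \<in> R \<Longrightarrow> j \<in> R \<Longrightarrow> card (sep U i j) + card (sep U j i) \<le> 16"
  shows "5 * card U \<le> 31 * card R + 5"
proof -
  note fin = balanced_finite[OF bal]
  define m where "m = card R"
  have S: "S \<subseteq> R" "finite S" "card S \<le> m" if "S \<in> U" for S
    using that fin by (auto simp: m_def intro: card_mono finite_subset)
  define U0 where "U0 = {S \<in> U. card S = 0 \<or> card S = m}"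
  define U1 where "U1 = {S \<in> U. card S = 1 \<or> card S = m - 1}"
  have "U0 \<subseteq> {{}, R}"
    using S fin by (auto simp: U0_def m_def dest: card_subset_eq[OF fin(1)])
  then have "card U0 \<le> card {{}, R}"
    by (intro card_mono) auto
  also have "\<dots> \<le> 2"
    by (simp add: card_insert_if)
  finally have c0: "card U0 \<le> 2" .
  have "U1 \<subseteq> (\<lambda>i. {i}) ` R \<union> (\<lambda>i. R - {i}) ` R"
  proof
    fix T assume T: "T \<in> U1"
    then have TR: "T \<in> U" "T \<subseteq> R" "finite T"
      using S by (auto simp: U1_def)
    from T consider "card T = 1" | "card T = m - 1"
      by (auto simp: U1_def)
    then show "T \<in> (\<lambda>i. {i}) ` R \<union> (\<lambda>i. R - {i}) ` R"
    proof cases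
      case 1
      then show ?thesis using TR by (auto simp: card_1_singleton_iff)
    next
      case 2
      have "card (R - T) = 1"
        using 2 TR fin m5 by (simp add: card_Diff_subset m_def)
      then obtain i where "R - T = {i}"
        by (auto simp: card_1_singleton_iff)
      then have "T = R - {i}" "i \<in> R"
        using TR by auto
      then show ?thesis by blast
    qed
  qed
  then have "card U1 \<le> card ((\<lambda>i. {i}) ` R \<union> (\<lambda>i. R - {i}) ` R)"
    using fin by (intro card_mono) auto
  also have "\<dots> \<le> card ((\<lambda>i. {i}) ` R) + card ((\<lambda>i. R - {i}) ` R)"
    by (rule card_Un_le)
  also have "\<dots> \<le> 2 * m"
    using card_image_le[OF fin(1), of "\<lambda>i. {i}"] card_image_le[OF fin(1), of "\<lambda>i. R - {i}"]
    by (simp add: m_def)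
  finally have c1: "card U1 \<le> 2 * m" .
  have cardT: "card {p \<in> R \<times> R. fst p \<in> T \<and> snd p \<notin> T} = card T * (m - card T)" if "T \<in> U" for T
  proof -
    have "{p \<in> R \<times> R. fst p \<in> T \<and> snd p \<notin> T} = T \<times> (R - T)"
      using S[OF that] by auto
    then show ?thesis
      using S[OF that] by (simp add: card_cartesian_product card_Diff_subset m_def)
  qed
  have "(\<Sum>T\<in>U. card T * (m - card T)) = (\<Sum>T\<in>U. card {p \<in> R \<times> R. fst p \<in> T \<and> snd p \<notin> T})"
    using cardT by simp
  also have "\<dots> = (\<Sum>p\<in>R \<times> R. card (sep U (fst p) (snd p)))"
    unfolding sep_def using fin by (intro finite_sum_card_swap) auto
  also have "\<dots> = (\<Sum>i\<in>R. \<Sum>j\<in>R. card (sep U i j))"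
    by (simp add: sum.cartesian_product case_prod_beta)
  finally have tot: "(\<Sum>T\<in>U. card T * (m - card T)) = (\<Sum>i\<in>R. \<Sum>j\<in>R. card (sep U i j))" .
  \<comment> \<open>Adding the transposed sum pairs each difference with its reverse, so the
    hypothesis gives 16 for every off-diagonal pair.\<close>
  have "2 * (\<Sum>i\<in>R. \<Sum>j\<in>R. card (sep U i j)) =
      (\<Sum>i\<in>R. \<Sum>j\<in>R. card (sep U i j)) + (\<Sum>j\<in>R. \<Sum>i\<in>R. card (sep U i j))"
    by (subst sum.swap[of _ R R]) simp
  also have "\<dots> = (\<Sum>i\<in>R. \<Sum>j\<in>R. card (sep U i j) + card (sep U j i))"
    by (simp add: sum.distrib)
  also have "\<dots> \<le> (\<Sum>i\<in>R. \<Sum>j\<in>R. 16 * of_bool (j \<noteq> i))"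
  proof (intro sum_mono)
    fix i j assume "i \<in> R" "j \<in> R"
    then show "card (sep U i j) + card (sep U j i) \<le> 16 * of_bool (j \<noteq> i)"
      using cut[of i j] by (cases "j = i") (auto simp: sep_def)
  qed
  also have "\<dots> = (\<Sum>i\<in>R. 16 * (m - 1))"
  proof (rule sum.cong[OF refl])
    fix i assume "i \<in> R"
    moreover have "R \<inter> {j. j \<noteq> i} = R - {i}"
      by auto
    ultimately have "card (R \<inter> {j. j \<noteq> i}) = m - 1"
      using fin(1) by (simp add: m_def)
    then show "(\<Sum>j\<in>R. 16 * of_bool (j \<noteq> i)) = 16 * (m - 1)"
      using fin(1) by (simp flip: sum_distrib_left)
  qed
  finally have "2 * (\<Sum>T\<in>U. card T * (m - card T)) \<le> 16 * (m * (m - 1))"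
    by (simp only: tot) (simp add: m_def)
  then have tot_le: "(\<Sum>T\<in>U. card T * (m - card T)) \<le> 8 * (m * (m - 1))"
    by simp
  \<comment> \<open>The correction terms fill the deficits: weight 0 at sizes 0 and m, and weight m
    - 1 = 2(m - 2) - (m - 3) at sizes 1 and m - 1.\<close>
  have ge: "2 * (m - 2) \<le> card T * (m - card T) + 2 * (m - 2) * of_bool (T \<in> U0)
      + (m - 3) * of_bool (T \<in> U1)" if T: "T \<in> U" for T
  proof -
    consider "card T = 0 \<or> card T = m" | "card T = 1" | "card T = m - 1"
      | "2 \<le> card T \<and> card T + 2 \<le> m"
      using S(3)[OF T] m5 by (force simp: m_def)
    then show ?thesis
    proof cases
      case 4
      then show ?thesis using card_cut_two_ge[of "card T" m] by simp
    qed (use T m5 in \<open>auto simp: U0_def U1_def m_def\<close>)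
  qed
  have "2 * (m - 2) * card U = (\<Sum>T\<in>U. 2 * (m - 2))"
    by simp
  also have "\<dots> \<le> (\<Sum>T\<in>U. card T * (m - card T) + 2 * (m - 2) * of_bool (T \<in> U0)
      + (m - 3) * of_bool (T \<in> U1))"
    by (intro sum_mono ge)
  also have "\<dots> = (\<Sum>T\<in>U. card T * (m - card T)) + 2 * (m - 2) * card U0 + (m - 3) * card U1"
  proof -
    have "U \<inter> U0 = U0" "U \<inter> U1 = U1"
      by (auto simp: U0_def U1_def)
    then show ?thesis
      using fin(2) by (simp add: sum.distrib flip: sum_distrib_left)
  qed
  also have "\<dots> \<le> 8 * (m * (m - 1)) + 2 * (m - 2) * 2 + (m - 3) * (2 * m)"
    using c0 c1 tot_le by (intro add_mono mult_le_mono) auto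
  finally have fin_ineq: "2 * (m - 2) * card U \<le> 8 * (m * (m - 1)) + 2 * (m - 2) * 2 + (m - 3) * (2 * m)" .
  \<comment> \<open>Up to a factor 2 the remaining slack is (6m - 2)(m - 5), which is zero at m = 5;
    in terms of \<open>k\<close> it is (6k + 28)k.\<close>
  obtain k where k: "m = k + 5"
    using m5 by (metis add.commute le_Suc_ex m_def)
  have "2 * (k + 3) * (5 * card U) \<le> 2 * (k + 3) * (31 * (k + 5) + 5)"
    using fin_ineq by (simp add: k algebra_simps)
  then show ?thesis
    by (simp add: k flip: m_def)
qed

subsection \<open>The crossing graph\<close>

text \<open>Closed balls about \<open>v\<close> in the crossing graph; their union is the component
  of \<open>v\<close>.\<close>

primrec nball :: "'a set \<Rightarrow> 'a set set \<Rightarrow> 'a \<Rightarrow> nat \<Rightarrow> 'a set" where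
  "nball R U v 0 = {v}"
| "nball R U v (Suc k) = nball R U v k \<union> (\<Union>x\<in>nball R U v k. nbrs R U x)"

lemma nball_subset: "v \<in> R \<Longrightarrow> nball R U v k \<subseteq> R"
  by (induction k) (auto simp: nbrs_def)

lemma nball_center: "v \<in> nball R U v k"
  by (induction k) auto

lemma nball_mono: "k \<le> l \<Longrightarrow> nball R U v k \<subseteq> nball R U v l"
  by (induction l rule: dec_induct) auto

text \<open>An empty layer leaves all later layers empty, so every layer before a reachable row is
  nonempty.\<close>

lemma nball_stable:
  assumes "nball R U v (Suc k) = nball R U v k"
  shows "nball R U v l \<subseteq> nball R U v k"
proof (induction l)
  case (Suc l)
  have "nball R U v (Suc l) \<subseteq> nball R U v (Suc k)"
    using Suc by auto
  then show ?case
    using assms by simp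
qed (use nball_center in auto)

text \<open>Differences obey a triangle inequality, \<open>sep U v y\<close> being covered by
  \<open>sep U v x\<close> and \<open>sep U x y\<close>, and each crossing step costs at most 8
  columns.\<close>

lemma card_sep_nball:
  assumes bal: "balanced R U" and v: "v \<in> R" and "y \<in> nball R U v k"
  shows "card (sep U v y) \<le> 8 * k"
  using assms(3)
proof (induction k arbitrary: y)
  case 0
  then show ?case by (auto simp: sep_def)
next
  case (Suc k)
  show ?case
  proof (cases "y \<in> nball R U v k")
    case True
    then show ?thesis using Suc.IH[of y] by simp
  next
    case False
    then obtain x where x: "x \<in> nball R U v k" "y \<in> nbrs R U x"
      using Suc.prems by auto
    then have "card (sep U x y) \<le> 8"
      using nball_subset[OF v] by (intro balanced_crossing[OF bal]) (auto simp: nbrs_def)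
    moreover have "card (sep U v y) \<le> card (sep U v x \<union> sep U x y)"
      using balanced_finite[OF bal] by (intro card_mono) (auto simp: sep_def)
    moreover have "card (sep U v x \<union> sep U x y) \<le> card (sep U v x) + card (sep U x y)"
      by (rule card_Un_le)
    ultimately show ?thesis
      using Suc.IH[OF x(1)] by simp
  qed
qed

text \<open>A neighbour of \<open>u\<close> within radius \<open>k\<close> would put
  \<open>u\<close> within radius \<open>k + 1\<close>.\<close>

lemma nbrs_nball_disjoint:
  assumes "v \<in> R" "u \<in> R" "u \<notin> nball R U v (Suc k)"
  shows "insert u (nbrs R U u) \<inter> nball R U v k = {}"
proof -
  have "y \<notin> nball R U v k" if "y \<in> nbrs R U u" for y
    using that assms by (auto simp: nbrs_def crossing_sym)
  then show ?thesis
    using assms by auto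
qed

lemma card_insert_nbrs:
  assumes "balanced R U"
  shows "card (insert u (nbrs R U u)) = Suc (card (nbrs R U u))"
  using balanced_finite(5)[OF assms] by (subst card_insert_disjoint) (auto simp: nbrs_def)

text \<open>Apart from the empty and the full column, every column misses \<open>v\<close>, contains
  \<open>w\<close>, or lies in \<open>sep U v w\<close>. The first two kinds are paid for by the
  neighbours of \<open>v\<close> and \<open>w\<close>, the third by the layers between them.\<close>

lemma card_le_of_far_pair:
  assumes bal: "balanced R U" and deg: "\<And>i. i \<in> R \<Longrightarrow> 3 \<le> card (nbrs R U i)"
    and v: "v \<in> R" and w: "w \<in> R"
    and max: "\<And>j. j \<in> R \<Longrightarrow> sep U v j = {} \<Longrightarrow> sep U j v = {}"
    and min: "\<And>j. j \<in> R \<Longrightarrow> sep U j w = {} \<Longrightarrow> sep U w j = {}"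
    and far: "w \<notin> nball R U v 2" and conn: "w \<in> nball R U v n"
  shows "5 * card U \<le> 31 * card R + 5"
proof -
  note fin = balanced_finite[OF bal]
  define B where "B = nball R U v"
  define D where "D = (LEAST k. w \<in> B k)"
  have wD: "w \<in> B D"
    unfolding D_def B_def using conn by (rule LeastI)
  have notw: "w \<notin> B k" if "k < D" for k
    using that unfolding D_def by (rule not_less_Least)
  have D3: "3 \<le> D"
  proof (rule ccontr)
    assume "\<not> 3 \<le> D"
    then have "B D \<subseteq> B 2"
      unfolding B_def by (intro nball_mono) simp
    then show False
      using wD far by (auto simp: B_def)
  qed
  have BR: "B k \<subseteq> R" for k
    using nball_subset[OF v] by (simp add: B_def)
  have finB: "finite (B k)" for k
    using BR fin(1) by (rule finite_subset)
  have grow: "B k \<subset> B (Suc k)" if "k < D" for k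
    using nball_stable[of R U v k D] notw[OF that] wD nball_mono[of k "Suc k" R U v]
    unfolding B_def by auto
  have step1: "Suc (card (B k)) \<le> card (B (Suc k))" if "k < D" for k
    using psubset_card_mono[OF finB grow[OF that]] by simp
  have step3: "card (B k) + 4 \<le> card (B (k + 3))" if k: "k + 1 < D" for k
  proof -
    \<comment> \<open>\<open>u\<close> is at distance exactly \<open>k + 2\<close> from
      \<open>v\<close>, so its closed neighbourhood lies in the layers \<open>k + 1\<close> to
      \<open>k + 3\<close>.\<close>
    obtain u where u: "u \<in> B (k + 2)" "u \<notin> B (Suc k)"
      using grow[of "Suc k"] k by auto
    then have uR: "u \<in> R"
      using BR by blast
    let ?N = "insert u (nbrs R U u)"
    have "?N \<subseteq> B (k + 3)"
      using u by (auto simp: B_def numeral_3_eq_3)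
    moreover have "B k \<subseteq> B (k + 3)"
      unfolding B_def by (intro nball_mono) simp
    ultimately have "card (?N \<union> B k) \<le> card (B (k + 3))"
      by (intro card_mono finB) auto
    moreover have "card (?N \<union> B k) = card ?N + card (B k)"
      using nbrs_nball_disjoint[OF v uR] u(2) finB fin
      by (intro card_Un_disjoint) (auto simp: B_def)
    ultimately show ?thesis
      using deg[OF uR] card_insert_nbrs[OF bal, of u] by linarith
  qed
  define d where "d = card (nbrs R U v)"
  define e where "e = card (nbrs R U w)"
  have B1: "card (B 1) = Suc d"
    using card_insert_nbrs[OF bal, of v] by (simp add: B_def d_def)
  text \<open>Three consecutive layers contain a closed neighbourhood, hence at least 4 rows, which
    contribute \<open>4 \<cdot> 62\<close> against the \<open>3 \<cdot> 80\<close> for three steps of distance.\<close>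
  have layers: "80 * k + 62 * d \<le> 54 + 62 * card (B k)" if "1 \<le> k" "k < D" for k
    using that
  proof (induction k rule: less_induct)
    case (less k)
    \<comment> \<open>Up to \<open>k = 3\<close> one row per layer beyond the first suffices;
      equality at \<open>k = 3\<close>, where 240 = 54 + 3 * 62, fixes the constant 54.\<close>
    consider "k = 1" | "k = 2" | "k = 3" | "4 \<le> k"
      using less.prems by linarith
    then show ?case
    proof cases
      case 1
      then show ?thesis using B1 by simp
    next
      case 2
      then show ?thesis using B1 step1[of 1] D3 by (simp add: numeral_2_eq_2)
    next
      case 3
      then show ?thesis using B1 step1[of 1] step1[of 2] D3
        by (simp add: numeral_2_eq_2 numeral_3_eq_3)
    next
      case 4
      then have "80 * (k - 3) + 62 * d \<le> 54 + 62 * card (B (k - 3))"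
        using less.prems by (intro less.IH) auto
      moreover have "card (B (k - 3)) + 4 \<le> card (B k)"
        using step3[of "k - 3"] 4 less.prems by simp
      ultimately show ?thesis
        using 4 by (simp add: diff_mult_distrib2)
    qed
  qed
  \<comment> \<open>The closed neighbourhood of \<open>w\<close> and the ball of radius
    \<open>D - 2\<close> about \<open>v\<close> are disjoint; as \<open>D\<close> is at least 3,
    that ball contains the neighbours of \<open>v\<close>.\<close>
  have "card (insert w (nbrs R U w) \<union> B (D - 2)) \<le> card R"
    using BR w fin by (intro card_mono) (auto simp: nbrs_def)
  moreover have "w \<notin> B (Suc (D - 2))"
    using D3 by (intro notw) simp
  then have "card (insert w (nbrs R U w) \<union> B (D - 2)) = card (insert w (nbrs R U w)) + card (B (D - 2))"
    using nbrs_nball_disjoint[OF v w] finB fin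
    by (intro card_Un_disjoint) (auto simp: B_def)
  ultimately have m: "Suc e + card (B (D - 2)) \<le> card R"
    using card_insert_nbrs[OF bal, of w] by (simp add: e_def)
  have "U \<subseteq> {{}, R} \<union> {S \<in> U. v \<notin> S \<and> S \<noteq> {}} \<union> {S \<in> U. w \<in> S \<and> S \<noteq> R} \<union> sep U v w"
    (is "_ \<subseteq> ?A \<union> ?X \<union> ?Y \<union> ?Z")
    by (auto simp: sep_def)
  then have "card U \<le> card (?A \<union> ?X \<union> ?Y \<union> ?Z)"
    using fin by (intro card_mono) auto
  also have "\<dots> \<le> card ?A + card ?X + card ?Y + card ?Z"
    by (meson add_le_mono1 card_Un_le le_trans)
  also have "card ?A \<le> 2"
    by (simp add: card_insert_if)
  finally have "card U \<le> 2 + card ?X + card ?Y + card ?Z"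
    by simp
  moreover have "card ?Z \<le> 8 * D"
    using bal v wD unfolding B_def by (rule card_sep_nball)
  moreover have "10 * card ?X + 81 \<le> 62 * d"
    using bal v deg[OF v] max unfolding d_def by (intro card_avoiding_maximal)
  moreover have "10 * card ?Y + 81 \<le> 62 * e"
    using bal w deg[OF w] min unfolding e_def by (intro card_containing_minimal)
  moreover have "80 * (D - 2) + 62 * d \<le> 54 + 62 * card (B (D - 2))"
    using D3 by (intro layers) auto
  \<comment> \<open>For 10 times \<open>card U\<close> the constants add up to 20 - 2 * 81 + 160 +
    54 - 62 = 10, exactly what the bound allows.\<close>
  ultimately show ?thesis
    using m D3 by (simp add: diff_mult_distrib2)
qed

text \<open>A column that misses some row of \<open>C\<close> and has a row outside \<open>C\<close>
  is excluded by \<open>below\<close>, so every column lies properly inside \<open>C\<close> or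
  contains \<open>C\<close>. The former are determined by their trace on \<open>C\<close>, the
  latter by their trace on \<open>R - C\<close>.\<close>

lemma card_split:
  assumes fin: "finite U" and UR: "U \<subseteq> Pow R" and ne: "U \<noteq> {}" and CR: "C \<subseteq> R"
    and below: "\<And>j c. j \<in> R - C \<Longrightarrow> c \<in> C \<Longrightarrow> sep U j c = {}"
  shows "card U + 1 \<le> card ((\<lambda>S. S \<inter> C) ` U) + card ((\<lambda>S. S \<inter> (R - C)) ` U)"
proof -
  let ?P = "(\<lambda>S. S \<inter> C) ` U" and ?Q = "(\<lambda>S. S \<inter> (R - C)) ` U"
  define U1 where "U1 = {S \<in> U. S \<subset> C}"
  define U2 where "U2 = {S \<in> U. C \<subseteq> S}"
  have "S \<in> U1 \<union> U2" if "S \<in> U" for S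
  proof (cases "C \<subseteq> S")
    case False
    then obtain c where c: "c \<in> C" "c \<notin> S" by auto
    have "S \<subseteq> C"
    proof
      fix j assume j: "j \<in> S"
      show "j \<in> C"
      proof (rule ccontr)
        assume "j \<notin> C"
        then have "sep U j c = {}"
          using j that UR c by (intro below) auto
        then show False
          using j c that by (auto simp: sep_def)
      qed
    qed
    then show ?thesis using False that by (auto simp: U1_def)
  qed (use that in \<open>auto simp: U2_def\<close>)
  then have "card U \<le> card (U1 \<union> U2)"
    using fin by (intro card_mono) (auto simp: U1_def U2_def)
  also have "\<dots> \<le> card U1 + card U2"
    by (rule card_Un_le)
  finally have le: "card U \<le> card U1 + card U2" .
  have U1P: "U1 \<subseteq> ?P - {C}"
    by (auto simp: U1_def image_iff Int_absorb2)
  have "inj_on (\<lambda>S. S \<inter> (R - C)) U2"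
  proof (rule inj_onI)
    fix S T assume ST: "S \<in> U2" "T \<in> U2" "S \<inter> (R - C) = T \<inter> (R - C)"
    then have "S = C \<union> S \<inter> (R - C)" "T = C \<union> T \<inter> (R - C)"
      using UR by (auto simp: U2_def)
    then show "S = T" using ST(3) by metis
  qed
  then have c2: "card U2 \<le> card ?Q"
    using fin by (intro card_inj_on_le) (auto simp: U2_def)
  \<comment> \<open>The extra 1: if some column contains \<open>C\<close>, then \<open>C\<close> is
    a trace that no member of \<open>U1\<close> has; otherwise any trace on \<open>R - C\<close>
    supplies it.\<close>
  show ?thesis
  proof (cases "U2 = {}")
    case True
    have "card U1 \<le> card ?P"
      using U1P fin by (intro card_mono) auto
    moreover have "card ?Q \<noteq> 0"
      using fin ne by auto
    ultimately show ?thesis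
      using le True by simp
  next
    case False
    then have "C \<in> ?P"
      by (auto simp: U2_def image_iff intro: sym)
    then have "card (?P - {C}) < card ?P"
      using fin by (intro card_Diff1_less) auto
    moreover have "card U1 \<le> card (?P - {C})"
      using U1P fin by (intro card_mono) auto
    ultimately show ?thesis
      using le c2 by simp
  qed
qed

text \<open>\<open>j\<close> crosses no row of the component, hence is nested with each. It lies
  below \<open>v\<close> by maximality, and along an edge from \<open>x\<close> to \<open>c\<close>
  it stays below, since \<open>j\<close> above \<open>c\<close> would put \<open>c\<close> below
  \<open>x\<close>.\<close>

lemma below_component:
  assumes v: "v \<in> R" and max: "\<And>j. j \<in> R \<Longrightarrow> sep U v j = {} \<Longrightarrow> sep U j v = {}"
    and j: "j \<in> R" "\<And>k. j \<notin> nball R U v k" and c: "c \<in> nball R U v k"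
  shows "sep U j c = {}"
  using c
proof (induction k arbitrary: c)
  case 0
  have "\<not> crossing U v j"
    using j(1) j(2)[of 1] by (auto simp: nbrs_def)
  then show ?case
    using 0 max[OF j(1)] by (auto simp: crossing_def)
next
  case (Suc k)
  show ?case
  proof (cases "c \<in> nball R U v k")
    case True
    then show ?thesis using Suc.IH by blast
  next
    case False
    then obtain x where x: "x \<in> nball R U v k" "c \<in> nbrs R U x"
      using Suc.prems by auto
    then have "crossing U c x"
      by (auto simp: nbrs_def crossing_sym)
    then have "sep U c x \<noteq> {}"
      by (simp add: crossing_def)
    moreover have "sep U c x \<subseteq> sep U c j \<union> sep U j x"
      by (auto simp: sep_def)
    ultimately have "sep U c j \<noteq> {}"
      using Suc.IH[OF x(1)] by auto
    moreover have "\<not> crossing U c j"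
      using j(1) j(2)[of "Suc (Suc k)"] Suc.prems by (auto simp: nbrs_def)
    ultimately show ?thesis
      by (auto simp: crossing_def)
  qed
qed

section \<open>Extremal rows and induction on the number of rows\<close>

lemma ex_maximal_row:
  assumes "finite R" "finite U" "i \<in> R"
  shows "\<exists>v\<in>R. sep U i v = {} \<and> (\<forall>j\<in>R. sep U v j = {} \<longrightarrow> sep U j v = {})"
proof -
  define X where "X = {v \<in> R. sep U i v = {}}"
  \<comment> \<open>Among the rows above \<open>i\<close>, one lying in the most columns is
    maximal.\<close>
  define f where "f v = card {S \<in> U. v \<in> S}" for v
  have X: "finite X" "X \<noteq> {}"
    using assms by (auto simp: X_def sep_def)
  then have "Max (f ` X) \<in> f ` X"
    by (intro Max_in) auto
  then obtain v where v: "v \<in> X" "f v = Max (f ` X)"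
    by auto
  have fmax: "f y \<le> f v" if "y \<in> X" for y
    using v that X by simp
  have "sep U j v = {}" if j: "j \<in> R" "sep U v j = {}" for j
  proof -
    have "j \<in> X"
      using j v(1) by (auto simp: X_def sep_def)
    then have "f j \<le> f v" by (rule fmax)
    moreover have "{S \<in> U. v \<in> S} \<subseteq> {S \<in> U. j \<in> S}"
      using j by (auto simp: sep_def)
    ultimately have "{S \<in> U. v \<in> S} = {S \<in> U. j \<in> S}"
      using assms by (intro card_seteq) (auto simp: f_def)
    then show ?thesis
      by (auto simp: sep_def)
  qed
  then show ?thesis
    using v(1) by (auto simp: X_def)
qed

lemma ex_minimal_row:
  assumes "finite R" "U \<subseteq> Pow R" "i \<in> R"
  shows "\<exists>w\<in>R. sep U w i = {} \<and> (\<forall>j\<in>R. sep U j w = {} \<longrightarrow> sep U w j = {})"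
proof -
  have "finite U"
    using assms by (meson finite_Pow_iff finite_subset)
  then show ?thesis
    using ex_maximal_row[of R "(\<lambda>S. R - S) ` U" i] assms by (auto simp: sep_complement)
qed

lemma balanced_card_le:
  "balanced R U \<Longrightarrow> 5 * card U \<le> 31 * card R + 5"
proof (induction "card R" arbitrary: R U rule: less_induct)
  case less
  note bal = less.prems
  note fin = balanced_finite[OF bal]
  have smaller: "5 * card ((\<lambda>S. S \<inter> R') ` U) \<le> 31 * card R' + 5" if "R' \<subset> R" for R'
    using that fin(1) by (intro less.hyps psubset_card_mono balanced_trace[OF bal]) auto
  consider "card R \<le> 4" | "U = {}"
    | i where "i \<in> R" "card {S \<in> U. i \<notin> S \<and> insert i S \<in> U} \<le> 6"
    | "\<not> card R \<le> 4" "\<And>i j. i \<in> R \<Longrightarrow> j \<in> R \<Longrightarrow> card (sep U i j) + card (sep U j i) \<le> 16"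
    | i j where "U \<noteq> {}" "\<And>i. i \<in> R \<Longrightarrow> \<not> card {S \<in> U. i \<notin> S \<and> insert i S \<in> U} \<le> 6"
        "i \<in> R" "j \<in> R" "\<not> card (sep U i j) + card (sep U j i) \<le> 16"
    by blast
  then show ?case
  proof cases
    case 1
    have "card U \<le> card (Pow R)"
      using fin by (intro card_mono) auto
    also have "\<dots> = 2 ^ card R"
      using fin by (simp add: card_Pow)
    finally have le: "card U \<le> 2 ^ card R" .
    have "card R \<in> {0, 1, 2, 3, 4}"
      using 1 by auto
    then show ?thesis
      using le by auto
  next
    case 3
    \<comment> \<open>Deleting \<open>i\<close> loses at most 6 columns, and 5 * 6 <= 31.\<close>
    have "5 * card ((\<lambda>S. S \<inter> (R - {i})) ` U) \<le> 31 * card (R - {i}) + 5"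
      using 3 by (intro smaller) auto
    moreover have "card R = Suc (card (R - {i}))"
      using card.remove[OF fin(1) 3(1)] .
    ultimately show ?thesis
      using card_trace_delete[OF fin(2,3) 3(1)] 3(2) by simp
  next
    case 4
    then show ?thesis
      by (intro card_le_of_cuts_le[OF bal]) auto
  next
    case 5
    have deg: "3 \<le> card (nbrs R U x)" if "x \<in> R" for x
      using card_nbrs_ge[OF bal that] 5(2)[OF that] by simp
    \<comment> \<open>A crossing pair is distinguished by at most 8 + 8 columns, so here the rows
      are nested and one difference holds all of them.\<close>
    have "card (sep U i j) + card (sep U j i) \<le> 16" if "crossing U i j"
      using balanced_crossing[OF bal 5(3,4) that]
        balanced_crossing[OF bal 5(4,3)] that crossing_sym[of U i j] by simp
    then have "sep U i j = {} \<or> sep U j i = {}"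
      using 5(5) by (auto simp: crossing_def)
    then obtain a b where ab: "a \<in> R" "b \<in> R" "16 < card (sep U a b)"
      using 5(3,4,5) by fastforce
    obtain v where v: "v \<in> R" "sep U a v = {}" "\<And>x. x \<in> R \<Longrightarrow> sep U v x = {} \<Longrightarrow> sep U x v = {}"
      using ex_maximal_row[OF fin(1,2) ab(1)] by blast
    obtain w where w: "w \<in> R" "sep U w b = {}" "\<And>x. x \<in> R \<Longrightarrow> sep U x w = {} \<Longrightarrow> sep U w x = {}"
      using ex_minimal_row[OF fin(1,3) ab(2)] by blast
    \<comment> \<open>Raising \<open>a\<close> to \<open>v\<close> and lowering \<open>b\<close> to
      \<open>w\<close> only enlarges the difference; more than 16 columns cannot arise in two
      crossing steps.\<close>
    have "sep U a b \<subseteq> sep U v w"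
      using v(2) w(2) by (auto simp: sep_def)
    then have "card (sep U a b) \<le> card (sep U v w)"
      using fin by (intro card_mono)
    then have far: "w \<notin> nball R U v 2"
      using card_sep_nball[OF bal v(1), of w 2] ab(3) by auto
    show ?thesis
    proof (cases "\<exists>n. w \<in> nball R U v n")
      case True
      then show ?thesis
        using card_le_of_far_pair[OF bal deg v(1) w(1) v(3) w(3) far] by blast
    next
      case False
      \<comment> \<open>The component of \<open>v\<close> contains \<open>v\<close> but not
        \<open>w\<close>, so induction applies to both parts; the 1 gained in
        \<open>card_split\<close> absorbs the second additive 5.\<close>
      define C where "C = (\<Union>k. nball R U v k)"
      have C: "C \<subseteq> R" "v \<in> C" "w \<notin> C"
          using nball_subset[OF v(1)] False by (auto simp: C_def nball_center)
      have "card U + 1 \<le> card ((\<lambda>S. S \<inter> C) ` U) + card ((\<lambda>S. S \<inter> (R - C)) ` U)"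
      proof (rule card_split[OF fin(2,3) 5(1) C(1)])
        fix x c assume "x \<in> R - C" "c \<in> C"
        then show "sep U x c = {}"
          using below_component[OF v(1,3), of x c] by (auto simp: C_def)
      qed
      moreover have "5 * card ((\<lambda>S. S \<inter> C) ` U) \<le> 31 * card C + 5"
        using C w(1) by (intro smaller) auto
      moreover have "5 * card ((\<lambda>S. S \<inter> (R - C)) ` U) \<le> 31 * card (R - C) + 5"
        using C v(1) by (intro smaller) auto
      moreover have "card R = card C + card (R - C)"
        using C(1) fin(1) by (metis card_Diff_subset card_mono finite_subset le_add_diff_inverse)
      ultimately show ?thesis
        by simp
    qed
  qed simp
qed

subsection \<open>Configurations and matrices\<close>

lemma bij_betw_pick:
  assumes "finite I"
  shows "bij_betw (pick I) {..<card I} I"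
  unfolding bij_betw_def
proof
  show inj: "inj_on (pick I) {..<card I}"
    by (rule inj_on_inverseI[where g = "\<lambda>i. card {a \<in> I. a < i}"]) (simp add: card_pick_le)
  have "pick I ` {..<card I} \<subseteq> I"
    by (auto simp: pick_in_set_le)
  then show "pick I ` {..<card I} = I"
    using assms inj by (intro card_seteq) (auto simp: card_image)
qed

text \<open>\<open>submatrix\<close> lists the chosen rows and columns increasingly; the two
  permutations allow any other order, so all pairs of injections arise.\<close>

lemma configuration_iff_injections:
  "F \<prec> A \<longleftrightarrow> (\<exists>f g. inj_on f {..<dim_row F} \<and> f ` {..<dim_row F} \<subseteq> {..<dim_row A} \<and>
     inj_on g {..<dim_col F} \<and> g ` {..<dim_col F} \<subseteq> {..<dim_col A} \<and>
     (\<forall>i<dim_row F. \<forall>j<dim_col F. A $$ (f i, g j) = F $$ (i, j)))"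
    (is "_ \<longleftrightarrow> (\<exists>f g. ?emb f g)")
proof
  assume "F \<prec> A"
  then obtain I J p q where IJ: "I \<subseteq> {..<dim_row A}" "J \<subseteq> {..<dim_col A}"
    and p: "p permutes {..<dim_row F}" and q: "q permutes {..<dim_col F}"
    and eq: "submatrix A I J = mat (dim_row F) (dim_col F) (\<lambda>(i, j). F $$ (p i, q j))"
    by (auto simp: configuration_def row_col_permutation_def)
  have sets: "{i. i < dim_row A \<and> i \<in> I} = I" "{j. j < dim_col A \<and> j \<in> J} = J"
    using IJ by auto
  have dims: "card I = dim_row F" "card J = dim_col F"
    using arg_cong[OF eq, of dim_row] arg_cong[OF eq, of dim_col] by (simp_all add: dim_submatrix sets)
  have "finite I" "finite J"
    using IJ by (auto intro: finite_subset)
  then have bij: "bij_betw (pick I) {..<dim_row F} I" "bij_betw (pick J) {..<dim_col F} J"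
    using bij_betw_pick[of I] bij_betw_pick[of J] by (simp_all add: dims)
  \<comment> \<open>The definition permutes the indices of \<open>F\<close>, so the embedding uses
    the inverse permutations.\<close>
  define f where "f = pick I \<circ> inv_into UNIV p"
  define g where "g = pick J \<circ> inv_into UNIV q"
  have f: "bij_betw f {..<dim_row F} I"
    unfolding f_def using permutes_imp_bij[OF permutes_inv[OF p]] bij(1) by (rule bij_betw_trans)
  have g: "bij_betw g {..<dim_col F} J"
    unfolding g_def using permutes_imp_bij[OF permutes_inv[OF q]] bij(2) by (rule bij_betw_trans)
  have "A $$ (f i, g j) = F $$ (i, j)"
    if ij: "i < dim_row F" "j < dim_col F" for i j
  proof -
    have lt: "inv_into UNIV p i < dim_row F" "inv_into UNIV q j < dim_col F"
      using ij permutes_in_image[OF permutes_inv[OF p], of i]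
        permutes_in_image[OF permutes_inv[OF q], of j] by auto
    have "A $$ (pick I (inv_into UNIV p i), pick J (inv_into UNIV q j)) = submatrix A I J $$ (inv_into UNIV p i, inv_into UNIV q j)"
      using lt by (subst submatrix_index) (simp_all add: sets dims)
    also have "\<dots> = F $$ (p (inv_into UNIV p i), q (inv_into UNIV q j))"
      using lt by (simp add: eq)
    finally show ?thesis
      by (simp add: f_def g_def permutes_inverses[OF p] permutes_inverses[OF q])
  qed
  moreover have "inj_on f {..<dim_row F}" "f ` {..<dim_row F} \<subseteq> {..<dim_row A}"
    "inj_on g {..<dim_col F}" "g ` {..<dim_col F} \<subseteq> {..<dim_col A}"
    using f g IJ by (simp_all only: bij_betw_def)
  ultimately show "\<exists>f g. ?emb f g"
    by blast
next
  assume "\<exists>f g. ?emb f g"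
  then obtain f g where emb: "?emb f g"
    by (elim exE)
  then have f: "inj_on f {..<dim_row F}" "f ` {..<dim_row F} \<subseteq> {..<dim_row A}"
    and g: "inj_on g {..<dim_col F}" "g ` {..<dim_col F} \<subseteq> {..<dim_col A}"
    by (simp_all only:)
  have eq: "A $$ (f i, g j) = F $$ (i, j)" if "i < dim_row F" "j < dim_col F" for i j
    using emb that by (simp only:)
  \<comment> \<open>Conversely, an injection is sorted by the permutation that makes its values
    increase.\<close>
  have perm: "\<exists>p. p permutes {..<n} \<and> (\<forall>a<n. h (p a) = pick (h ` {..<n}) a)"
    if h: "inj_on h {..<n}" for h and n :: nat
  proof -
    let ?p = "\<lambda>a. if a \<in> {..<n} then inv_into {..<n} h (pick (h ` {..<n}) a) else a"
    have "bij_betw (pick (h ` {..<n})) {..<n} (h ` {..<n})"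
      using bij_betw_pick[of "h ` {..<n}"] h by (simp add: card_image)
    moreover from this have "bij_betw (inv_into {..<n} h \<circ> pick (h ` {..<n})) {..<n} {..<n}"
      using h by (intro bij_betw_trans[OF _ bij_betw_inv_into]) (auto simp: bij_betw_def)
    then have "bij_betw ?p {..<n} {..<n}"
      by (rule bij_betw_cong[THEN iffD1, rotated]) auto
    then have "?p permutes {..<n}"
      by (rule bij_imp_permutes) auto
    moreover have "h (?p a) = pick (h ` {..<n}) a" if "a < n" for a
      using that bij_betwE[OF calculation(1)] by (simp add: f_inv_into_f)
    ultimately show ?thesis by blast
  qed
  obtain p where p: "p permutes {..<dim_row F}"
    "\<And>a. a < dim_row F \<Longrightarrow> f (p a) = pick (f ` {..<dim_row F}) a"
    using perm[OF f(1)] by blast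
  obtain q where q: "q permutes {..<dim_col F}"
    "\<And>a. a < dim_col F \<Longrightarrow> g (q a) = pick (g ` {..<dim_col F}) a"
    using perm[OF g(1)] by blast
  let ?I = "f ` {..<dim_row F}" and ?J = "g ` {..<dim_col F}"
  have sets: "{i. i < dim_row A \<and> i \<in> ?I} = ?I" "{j. j < dim_col A \<and> j \<in> ?J} = ?J"
    using f g by auto
  have "submatrix A ?I ?J = mat (dim_row F) (dim_col F) (\<lambda>(i, j). F $$ (p i, q j))"
  proof (rule eq_matI)
    fix i j assume "i < dim_row (mat (dim_row F) (dim_col F) (\<lambda>(i, j). F $$ (p i, q j)))"
      "j < dim_col (mat (dim_row F) (dim_col F) (\<lambda>(i, j). F $$ (p i, q j)))"
    then have ij: "i < dim_row F" "j < dim_col F" by auto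
    have lt: "p i < dim_row F" "q j < dim_col F"
      using ij permutes_in_image[OF p(1), of i] permutes_in_image[OF q(1), of j] by auto
    have "submatrix A ?I ?J $$ (i, j) = A $$ (pick ?I i, pick ?J j)"
      using ij f g by (intro submatrix_index) (simp_all only: sets, simp_all add: card_image)
    also have "\<dots> = A $$ (f (p i), g (q j))"
      using ij by (simp add: p q)
    finally show "submatrix A ?I ?J $$ (i, j)
        = mat (dim_row F) (dim_col F) (\<lambda>(i, j). F $$ (p i, q j)) $$ (i, j)"
      using ij eq[OF lt] by simp
  qed (simp_all only: dim_submatrix sets, simp_all add: card_image f g)
  then show "F \<prec> A"
    using f g p(1) q(1) unfolding configuration_def row_col_permutation_def by blast
qed

section \<open>The configuration F(0,p,1,0) and the upper bound for matrices\<close>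

lemma F0p10_dim [simp]: "dim_row (F0p10 p) = 2" "dim_col (F0p10 p) = Suc p"
  by (simp_all add: F0p10_def)

lemma F0p10_index:
  assumes "j < Suc p"
  shows "F0p10 p $$ (0, j) = of_bool (j < p)" "F0p10 p $$ (1, j) = of_bool (\<not> j < p)"
  using assms by (auto simp: F0p10_def mat_of_cols_index nth_append vec_of_list_index less_Suc_eq)

lemma F0p10_configuration_iff:
  "F0p10 p \<prec> A \<longleftrightarrow> (\<exists>i<dim_row A. \<exists>i'<dim_row A. i \<noteq> i' \<and>
     p \<le> card {j. j < dim_col A \<and> A $$ (i, j) = 1 \<and> A $$ (i', j) = 0} \<and>
     (\<exists>j<dim_col A. A $$ (i, j) = 0 \<and> A $$ (i', j) = 1))"
proof
  assume "F0p10 p \<prec> A"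
  then obtain f g where f: "inj_on f {..<2}" "f ` {..<2} \<subseteq> {..<dim_row A}"
    and g: "inj_on g {..<Suc p}" "g ` {..<Suc p} \<subseteq> {..<dim_col A}"
    and eq: "\<And>i j. i < 2 \<Longrightarrow> j < Suc p \<Longrightarrow> A $$ (f i, g j) = F0p10 p $$ (i, j)"
    unfolding configuration_iff_injections by auto
  have rows: "f 0 < dim_row A" "f 1 < dim_row A" "f 0 \<noteq> f 1"
    using f(2) inj_onD[OF f(1), of 0 1] by (auto simp: image_subset_iff)
  have e: "A $$ (f 0, g j) = of_bool (j < p)" "A $$ (f 1, g j) = of_bool (\<not> j < p)"
    if "j < Suc p" for j
    using that eq[of 0 j] eq[of 1 j] by (simp_all add: F0p10_index F0p10_index[simplified])
  have gA: "g j < dim_col A" if "j < Suc p" for j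
    using g(2) that by (auto simp: image_subset_iff)
  have "inj_on g {..<p}"
    using g(1) by (rule inj_on_subset) auto
  then have "p = card (g ` {..<p})"
    by (simp add: card_image)
  also have "\<dots> \<le> card {j. j < dim_col A \<and> A $$ (f 0, j) = 1 \<and> A $$ (f 1, j) = 0}"
    using gA e by (intro card_mono) auto
  finally have "p \<le> card {j. j < dim_col A \<and> A $$ (f 0, j) = 1 \<and> A $$ (f 1, j) = 0}" .
  moreover have "g p < dim_col A" "A $$ (f 0, g p) = 0" "A $$ (f 1, g p) = 1"
    using gA[of p] e[of p] by auto
  ultimately show "\<exists>i<dim_row A. \<exists>i'<dim_row A. i \<noteq> i' \<and>
     p \<le> card {j. j < dim_col A \<and> A $$ (i, j) = 1 \<and> A $$ (i', j) = 0} \<and>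
     (\<exists>j<dim_col A. A $$ (i, j) = 0 \<and> A $$ (i', j) = 1)"
    using rows by blast
next
  assume "\<exists>i<dim_row A. \<exists>i'<dim_row A. i \<noteq> i' \<and>
     p \<le> card {j. j < dim_col A \<and> A $$ (i, j) = 1 \<and> A $$ (i', j) = 0} \<and>
     (\<exists>j<dim_col A. A $$ (i, j) = 0 \<and> A $$ (i', j) = 1)"
  then obtain i i' k where i: "i < dim_row A" "i' < dim_row A" "i \<noteq> i'"
    and c: "p \<le> card {j. j < dim_col A \<and> A $$ (i, j) = 1 \<and> A $$ (i', j) = 0}"
    and k: "k < dim_col A" "A $$ (i, k) = 0" "A $$ (i', k) = 1"
    by blast
  obtain T where T: "T \<subseteq> {j. j < dim_col A \<and> A $$ (i, j) = 1 \<and> A $$ (i', j) = 0}" "card T = p" "finite T"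
    using obtain_subset_with_card_n[OF c] by blast
  then obtain h where h: "bij_betw h {..<p} T"
    using ex_bij_betw_nat_finite[OF T(3)] by (auto simp: atLeast0LessThan)
  define f where "f a = (if a = (0::nat) then i else i')" for a
  \<comment> \<open>The last column of the configuration goes to \<open>k\<close>, which lies
    outside \<open>T\<close> because its entry in row \<open>i\<close> is 0.\<close>
  define g where "g = h(p := k)"
  have hT: "h j \<in> T" if "j < p" for j
    using that h by (auto simp: bij_betw_def)
  then have hA: "h j < dim_col A" if "j < p" for j
    using that T(1) by blast
  have "k \<notin> T"
    using T k by auto
  moreover have "bij_betw g {..<p} T"
    using h by (rule bij_betw_cong[THEN iffD1, rotated]) (simp add: g_def)
  moreover have "g p = k"
    by (simp add: g_def)
  ultimately have "inj_on g {..<Suc p}"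
    by (simp add: lessThan_Suc bij_betw_def)
  moreover have "g ` {..<Suc p} \<subseteq> {..<dim_col A}"
    using hA k by (auto simp: g_def less_Suc_eq)
  moreover have "inj_on f {..<2}" "f ` {..<2} \<subseteq> {..<dim_row A}"
    using i by (auto simp: f_def inj_on_def)
  moreover have "A $$ (f a, g j) = F0p10 p $$ (a, j)" if "a < 2" "j < Suc p" for a j
  proof -
    have "a = 0 \<or> a = 1"
      using that by auto
    moreover have "j < p \<or> j = p"
      using that by auto
    ultimately show ?thesis
      using that T hT[of j] k by (auto simp: f_def g_def F0p10_index F0p10_index[simplified])
  qed
  ultimately show "F0p10 p \<prec> A"
    unfolding configuration_iff_injections F0p10_dim by blast
qed

text \<open>Simplicity makes the passage from columns to their supports injective, so the family of
  supports has as many members as the matrix has columns.\<close>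

lemma dim_col_Avoid_le:
  assumes "A \<in> Avoid m (F0p10 9)"
  shows "5 * dim_col A \<le> 31 * m + 5"
proof -
  have r: "dim_row A = m" and d: "distinct (cols A)" and nF: "\<not> F0p10 9 \<prec> A"
    and e: "elements_mat A \<subseteq> {0, 1}"
    using assms by (auto simp: Avoid_def simple_mat_def zero_one_mat_def)
  have e01: "A $$ (i, j) = 0 \<or> A $$ (i, j) = 1" if "i < m" "j < dim_col A" for i j
    using that e r elements_matI[of A m "dim_col A" i j] by blast
  define s where "s j = {i. i < m \<and> A $$ (i, j) = 1}" for j
  have inj: "inj_on s {..<dim_col A}"
  proof (rule inj_onI)
    fix j j' assume j: "j \<in> {..<dim_col A}" "j' \<in> {..<dim_col A}" "s j = s j'"
    have "A $$ (i, j) = A $$ (i, j')" if "i < m" for i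
    proof -
      have "i \<in> s j \<longleftrightarrow> i \<in> s j'"
        using j(3) by simp
      then show ?thesis
        using e01[OF that, of j] e01[OF that, of j'] j(1,2) that by (auto simp: s_def)
    qed
    then have "col A j = col A j'"
      using j r by (intro eq_vecI) auto
    then have "cols A ! j = cols A ! j'"
      using j by simp
    then show "j = j'"
      using j d nth_eq_iff_index_eq[of "cols A" j j'] by simp
  qed
  define U where "U = s ` {..<dim_col A}"
  have sep: "sep U i i' = s ` {j. j < dim_col A \<and> A $$ (i, j) = 1 \<and> A $$ (i', j) = 0}"
    if "i < m" "i' < m" for i i'
  proof -
    have "sep U i i' = s ` {j. j < dim_col A \<and> i \<in> s j \<and> i' \<notin> s j}"
      by (auto simp: sep_def U_def)
    also have "{j. j < dim_col A \<and> i \<in> s j \<and> i' \<notin> s j}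
        = {j. j < dim_col A \<and> A $$ (i, j) = 1 \<and> A $$ (i', j) = 0}"
      using that e01[OF that(2)] by (fastforce simp: s_def)
    finally show ?thesis .
  qed
  have "card (sep U i i') \<le> 8 \<or> sep U i' i = {}" if "i < m" "i' < m" for i i'
  proof (rule ccontr)
    assume "\<not> ?thesis"
    then have *: "9 \<le> card (sep U i i')" "sep U i' i \<noteq> {}"
      by auto
    have "i \<noteq> i'"
      using *(2) by (auto simp: sep_def)
    moreover have "9 \<le> card {j. j < dim_col A \<and> A $$ (i, j) = 1 \<and> A $$ (i', j) = 0}"
      using *(1) card_image_le[of "{j. j < dim_col A \<and> A $$ (i, j) = 1 \<and> A $$ (i', j) = 0}" s]
      by (simp add: sep[OF that])
    moreover have "\<exists>j<dim_col A. A $$ (i, j) = 0 \<and> A $$ (i', j) = 1"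
      using *(2) by (auto simp: sep[OF that(2,1)])
    ultimately show False
      using nF that r unfolding F0p10_configuration_iff by blast
  qed
  then have "balanced {..<m} U"
    by (auto simp: balanced_def U_def s_def)
  then have "5 * card U \<le> 31 * card {..<m} + 5"
    by (rule balanced_card_le)
  then show ?thesis
    using inj by (simp add: U_def card_image)
qed

section \<open>The extremal block matrix\<close>

text \<open>Column \<open>31 b + v\<close> holds the binary digits of \<open>v\<close> in block \<open>b\<close>, ones in earlier blocks and
  zeros in later ones: truncated subtraction and \<open>min\<close> clip the digit source to \<open>{0..31}\<close>.\<close>
definition block_entry :: "nat \<Rightarrow> nat \<Rightarrow> nat" where
  "block_entry i j = min 31 (j - 31 * (i div 5)) div 2 ^ (i mod 5) mod 2"

lemma bits5_eqI:
  assumes "x < 32" "y < 32" "\<And>c. c < 5 \<Longrightarrow> x div 2 ^ c mod 2 = y div 2 ^ c mod (2::nat)"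
  shows "x = (y::nat)"
proof -
  have "x div 2 ^ c mod 2 = y div 2 ^ c mod 2" for c
  proof (cases "c < 5")
    case False
    then have "(2::nat) ^ 5 \<le> 2 ^ c"
      by (intro power_increasing) auto
    then show ?thesis
      using assms by simp
  qed (use assms in auto)
  then show ?thesis
    by (intro bit_eqI) (simp add: bit_iff_odd odd_iff_mod_2_eq_one)
qed

text \<open>Two prescribed bits leave three free ones, hence at most 2^3 values; for
  \<open>c = c'\<close> the prescriptions conflict.\<close>

lemma card_bits5:
  assumes "c < 5" "c' < 5"
  shows "card {v \<in> {0..<32}. v div 2 ^ c mod 2 = 1 \<and> v div 2 ^ c' mod 2 = (0::nat)} \<le> 8"
    (is "card ?V \<le> 8")
proof (cases "c = c'")
  case False
  let ?D = "{..<5} - {c, c'}"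
  define h where "h v = {d \<in> ?D. v div 2 ^ d mod 2 = 1}" for v :: nat
  have "inj_on h ?V"
  proof (rule inj_onI)
    fix v w assume v: "v \<in> ?V" "w \<in> ?V" "h v = h w"
    show "v = w"
    proof (rule bits5_eqI)
      fix d :: nat assume d: "d < 5"
      show "v div 2 ^ d mod 2 = w div 2 ^ d mod 2"
      proof (cases "d \<in> ?D")
        case True
        then have "v div 2 ^ d mod 2 = 1 \<longleftrightarrow> w div 2 ^ d mod 2 = 1"
          using v(3) unfolding h_def by blast
        then show ?thesis by (metis not_mod_2_eq_1_eq_0)
      qed (use v d in auto)
    qed (use v in auto)
  qed
  then have "card ?V \<le> card (Pow ?D)"
    by (intro card_inj_on_le[of h]) (auto simp: h_def)
  then show ?thesis
    using assms False by (simp add: card_Pow card_Diff_subset)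
next
  case True
  then have "?V = {}"
    by auto
  then show ?thesis
    by (simp only: card.empty)
qed

text \<open>Rows of different blocks are nested, the earlier above the later. Rows of one block
  differ only on its own 32 columns, where \<open>card_bits5\<close> applies.\<close>

lemma block_matrix_Avoid:
  "mat (5 * k) (31 * k + 1) (\<lambda>(i, j). block_entry i j) \<in> Avoid (5 * k) (F0p10 9)"
proof -
  let ?A = "mat (5 * k) (31 * k + 1) (\<lambda>(i, j). block_entry i j)"
  have "zero_one_mat ?A"
    by (auto simp: zero_one_mat_def elements_mat_def block_entry_def)
  moreover have "distinct (cols ?A)"
  proof -
    have "cols ?A ! j \<noteq> cols ?A ! j'" if j: "j < j'" "j' < 31 * k + 1" for j j'
    proof
      assume "cols ?A ! j = cols ?A ! j'"
      then have eq: "col ?A j = col ?A j'"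
        using j by simp
      \<comment> \<open>Block \<open>b\<close> tells the columns apart: its digit source at
        \<open>j\<close> is below 31, so clipping cannot identify it with the source at the larger
        \<open>j'\<close>.\<close>
      define b where "b = j div 31"
      have bj: "31 * b \<le> j" "j < 31 * b + 31"
        unfolding b_def by simp_all
      have bk: "b < k"
        using j bj by linarith
      have "min 31 (j - 31 * b) = min 31 (j' - 31 * b)"
      proof (rule bits5_eqI)
        fix c :: nat assume c: "c < 5"
        have "5 * b + c < 5 * k"
          using bk c by linarith
        then have "block_entry (5 * b + c) j = block_entry (5 * b + c) j'"
          using arg_cong[OF eq, of "\<lambda>v. v $ (5 * b + c)"] j by simp
        then show "min 31 (j - 31 * b) div 2 ^ c mod 2 = min 31 (j' - 31 * b) div 2 ^ c mod 2"
          using c by (simp add: block_entry_def)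
      qed auto
      then show False
        using j bj by (simp add: min_def split: if_splits)
    qed
    then show ?thesis
      unfolding distinct_conv_nth by (metis cols_length dim_col_mat(1) nat_neq_iff)
  qed
  moreover have "\<not> F0p10 9 \<prec> ?A"
  proof
    assume "F0p10 9 \<prec> ?A"
    then obtain i i' j where i: "i < 5 * k" "i' < 5 * k"
      and c: "9 \<le> card {j. j < 31 * k + 1 \<and> ?A $$ (i, j) = 1 \<and> ?A $$ (i', j) = 0}"
      and j: "j < 31 * k + 1" "?A $$ (i, j) = 0" "?A $$ (i', j) = 1"
      unfolding F0p10_configuration_iff by auto
    let ?S = "{j. j < 31 * k + 1 \<and> block_entry i j = 1 \<and> block_entry i' j = 0}"
    have "{j. j < 31 * k + 1 \<and> ?A $$ (i, j) = 1 \<and> ?A $$ (i', j) = 0} = ?S"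
      using i by auto
    with c have S: "9 \<le> card ?S" by simp
    have j': "block_entry i j = 0" "block_entry i' j = 1"
      using i j by auto
    have ones: "block_entry x y = 1" if "31 * (x div 5) + 31 \<le> y" for x y
    proof -
      have "min 31 (y - 31 * (x div 5)) = 31" "x mod 5 < 5"
        using that by auto
      moreover have "\<forall>c<5. 31 div 2 ^ c mod 2 = (1::nat)"
        by code_simp
      ultimately show ?thesis
        by (simp add: block_entry_def)
    qed
    have zeros: "block_entry x y = 0" if "y \<le> 31 * (x div 5)" for x y
      using that by (simp add: block_entry_def)
    consider "i div 5 < i' div 5" | "i' div 5 < i div 5" | "i div 5 = i' div 5"
      by linarith
    then show False
    proof cases
      case 1
      then show False
        using ones[of i j] zeros[of j i'] j' by linarith
    next
      case 2
      have False if "y \<in> ?S" for y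
      proof -
        have "31 * (i' div 5) + 31 \<le> y \<or> y \<le> 31 * (i div 5)"
          using 2 by linarith
        then show False
          using that ones[of i' y] zeros[of y i] by auto
      qed
      then have "?S = {}" by blast
      then have "card ?S = 0" by (simp only: card.empty)
      then show False
        using S by linarith
    next
      case 3
      define b where "b = i div 5"
      let ?V = "{v \<in> {0..<32}. v div 2 ^ (i mod 5) mod 2 = 1 \<and> v div 2 ^ (i' mod 5) mod 2 = (0::nat)}"
      have "y \<in> (\<lambda>v. 31 * b + v) ` ?V" if y: "y \<in> ?S" for y
      proof -
        \<comment> \<open>The 1 in row \<open>i\<close> and the 0 in row \<open>i'\<close> keep
          \<open>y\<close> within the block, so no clipping occurs.\<close>
        have "31 * b \<le> y" "y \<le> 31 * b + 31"
          using y zeros[of y i] ones[of i' y] 3 by (auto simp: b_def not_le intro: ccontr)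
        moreover from this have "block_entry i y = (y - 31 * b) div 2 ^ (i mod 5) mod 2"
          "block_entry i' y = (y - 31 * b) div 2 ^ (i' mod 5) mod 2"
          using 3 by (simp_all add: block_entry_def b_def min_absorb2)
        then have "y - 31 * b \<in> ?V"
          using y calculation by simp
        ultimately show ?thesis
          by (intro image_eqI[of _ _ "y - 31 * b"]) auto
      qed
      then have "card ?S \<le> card ((\<lambda>v. 31 * b + v) ` ?V)"
        by (intro card_mono) auto
      also have "\<dots> \<le> card ?V"
        by (intro card_image_le) auto
      also have "card ?V \<le> 8"
        by (intro card_bits5) auto
      finally show False
        using S by simp
    qed
  qed
  ultimately show ?thesis
    by (simp add: Avoid_def simple_mat_def)
qed

theorem theorem4:
  fixes m :: nat
  assumes "m > 0"
  shows "int (forb m (F0p10 9)) \<le> \<lfloor>(31 / 5 :: real) * real m\<rfloor> + 1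
    \<and> (m mod 5 = 0 \<longrightarrow> int (forb m (F0p10 9)) = \<lfloor>(31 / 5 :: real) * real m\<rfloor> + 1)"
proof -
  let ?F = "F0p10 9"
  have "forb m ?F \<in> dim_col ` Avoid m ?F"
    unfolding forb_def using finite_dim_col_Avoid Avoid_nonempty by (intro Max_in) auto
  then have "5 * forb m ?F \<le> 31 * m + 5"
    using dim_col_Avoid_le by auto
  then have "int (forb m ?F) - 1 \<le> \<lfloor>(31 / 5 :: real) * real m\<rfloor>"
    unfolding le_floor_iff by simp
  moreover have "\<lfloor>(31 / 5 :: real) * real m\<rfloor> + 1 \<le> int (forb m ?F)" if m5: "m mod 5 = 0"
  proof -
    obtain k where k: "m = 5 * k"
      using m5 by (meson mod_0_imp_dvd dvdE)
    have "31 * k + 1 \<in> dim_col ` Avoid m ?F"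
      using block_matrix_Avoid[of k] by (auto simp: k image_iff intro!: bexI)
    then have "31 * k + 1 \<le> forb m ?F"
      unfolding forb_def by (intro Max_ge finite_dim_col_Avoid)
    moreover have "\<lfloor>(31 / 5 :: real) * real m\<rfloor> = 31 * int k"
      by (simp add: k floor_eq_iff)
    ultimately show ?thesis
      by linarith
  qed
  ultimately show ?thesis
    by force
qed

end
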